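(* Let $G$ be a graph containing a vertex $v$ of degree at most $\chi(G)-1$. Then at least one of the following holds: (i) $G$ is recolorable; (ii) $G-v$ is not recolorable.
   Context: All graphs are finite and simple. A $k$-coloring of $G$ is a map $V(G)\to\{1,\dots,k\}$ giving adjacent vertices different values; $\chi(G)$ is the chromatic number. $R_k(G)$ denotes the graph whose vertices are the $k$-colorings of $G$, two being adjacent if they differ in color on exactly one vertex. $G$ is recolorable if $R_\ell(G)$ is connected for all $\ell\ge\chi(G)+1$. $G-v$ is the graph obtained from $G$ by deleting $v$. *)

theory Defs
  imports "Graph_Theory.Graph_Theory" "HOL-Library.FuncSet"
begin

text \<open>
  A finite simple graph is a symmetric loop-free digraph without parallel arcs (locale
  \<^locale>\<open>graph\<close>); each undirected edge is a pair of opposite arcs, so the degree of a vertex is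
  its \<^const>\<open>out_degree\<close>.
\<close>

text \<open>
  Colorings are extensional (\<^const>\<open>undefined\<close> outside the vertex set), so that two colorings
  are equal iff they agree on all vertices.
\<close>

definition colorings :: "('a, 'b) pre_digraph \<Rightarrow> nat \<Rightarrow> ('a \<Rightarrow> nat) set" where
  "colorings G k =
     {c \<in> verts G \<rightarrow>\<^sub>E {1..k}. \<forall>u v. u \<rightarrow>\<^bsub>G\<^esub> v \<longrightarrow> c u \<noteq> c v}"

definition chromatic_number :: "('a, 'b) pre_digraph \<Rightarrow> nat" where
  "chromatic_number G = (LEAST k. colorings G k \<noteq> {})"

definition recoloring_graph ::
  "('a, 'b) pre_digraph \<Rightarrow> nat \<Rightarrow> ('a \<Rightarrow> nat, ('a \<Rightarrow> nat) \<times> ('a \<Rightarrow> nat)) pre_digraph" where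
  "recoloring_graph G k =
     \<lparr>verts = colorings G k,
      arcs = {(c, d). c \<in> colorings G k \<and> d \<in> colorings G k \<and> (\<exists>!v. v \<in> verts G \<and> c v \<noteq> d v)},
      tail = fst, head = snd\<rparr>"

definition recolorable :: "('a, 'b) pre_digraph \<Rightarrow> bool" where
  "recolorable G \<longleftrightarrow> (\<forall>l \<ge> chromatic_number G + 1. Digraph_Component.connected (recoloring_graph G l))"

lemma graph_recoloring_graph:
  assumes "graph G"
  shows "graph (recoloring_graph G k)"
proof -
  interpret graph G by fact
  have fin: "finite (colorings G k)"
    unfolding colorings_def by (rule finite_subset[OF _ finite_PiE[of "verts G" "\<lambda>_. {1..k}"]]) auto
  have "arcs (recoloring_graph G k) \<subseteq> colorings G k \<times> colorings G k"
    by (auto simp: recoloring_graph_def)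
  then have "finite (arcs (recoloring_graph G k))"
    using fin by (meson finite_SigmaI finite_subset)
  moreover have "symmetric (recoloring_graph G k)"
    unfolding symmetric_conv
  proof
    fix e assume "e \<in> arcs (recoloring_graph G k)"
    then have "(snd e, fst e) \<in> arcs (recoloring_graph G k)"
      by (auto simp: recoloring_graph_def eq_commute)
    then show "\<exists>e'\<in>arcs (recoloring_graph G k).
        tail (recoloring_graph G k) e = head (recoloring_graph G k) e' \<and>
        head (recoloring_graph G k) e = tail (recoloring_graph G k) e'"
      by (rule rev_bexI) (simp add: recoloring_graph_def)
  qed
  ultimately show ?thesis
    using fin by unfold_locales (auto simp: recoloring_graph_def arc_to_ends_def)
qed

lemma colorings_chromatic_number_nonempty:
  assumes "graph G"
  shows "colorings G (chromatic_number G) \<noteq> {}"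
proof -
  interpret graph G by fact
  obtain f :: "'a \<Rightarrow> nat" and n where f: "f ` verts G = {i. i < n}" "inj_on f (verts G)"
    using finite_imp_inj_to_nat_seg[OF finite_verts] by metis
  have lt: "f u < n" if "u \<in> verts G" for u
    using f(1) that by blast
  have "f u \<noteq> f v" if "u \<rightarrow>\<^bsub>G\<^esub> v" for u v
    using f(2) adj_in_verts[OF that] adj_not_same that by (metis inj_onD)
  then have "restrict (\<lambda>v. Suc (f v)) (verts G) \<in> colorings G n"
    using lt by (auto simp: colorings_def Suc_le_eq adj_in_verts)
  then show ?thesis
    unfolding chromatic_number_def by (metis (mono_tags, lifting) LeastI empty_iff)
qed

end

theory Submission
  imports Defs
begin

text \<open>
  If \<open>G - v\<close> is recolorable, then so is \<open>G\<close>: a walk in \<open>R\<^sub>l(G - v)\<close> lifts to \<open>R\<^sub>l(G)\<close>. Whenever a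
  vertex is about to receive a color \<open>b\<close>, first move \<open>v\<close> to a color that is neither \<open>b\<close> nor used
  on the neighborhood of \<open>v\<close>; it exists since \<open>deg v + 1 < l\<close>. At the end of the walk only the
  color of \<open>v\<close> is left to be corrected.
\<close>

lemma adj_del_vert_iff:
  "u \<rightarrow>\<^bsub>pre_digraph.del_vert G v\<^esub> w \<longleftrightarrow> u \<rightarrow>\<^bsub>G\<^esub> w \<and> u \<noteq> v \<and> w \<noteq> v"
  by (auto simp: arcs_ends_conv pre_digraph.del_vert_simps)

lemma graph_del_vert:
  assumes "graph G"
  shows "graph (pre_digraph.del_vert G v)"
proof -
  interpret graph G by fact
  have "symmetric (del_vert v)"
    using graph_symmetric by (auto simp: symmetric_def sym_def adj_del_vert_iff)
  moreover have "nomulti_digraph (del_vert v)"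
    using wf_digraph_del_vert no_multi_arcs
    by (simp add: nomulti_digraph_def nomulti_digraph_axioms_def del_vert_simps arc_to_ends_def)
  moreover have "loopfree_digraph (del_vert v)"
    using wf_digraph_del_vert no_loops
    by (simp add: loopfree_digraph_def loopfree_digraph_axioms_def del_vert_simps)
  ultimately show ?thesis
    using fin_digraph_del_vert by (intro digraph.graphI digraph.intro)
qed

lemma (in fin_digraph) card_neighbors_le_out_degree:
  "finite {u. v \<rightarrow>\<^bsub>G\<^esub> u}" "card {u. v \<rightarrow>\<^bsub>G\<^esub> u} \<le> out_degree G v"
proof -
  have "{u. v \<rightarrow>\<^bsub>G\<^esub> u} = head G ` out_arcs G v"
    by (auto simp: arcs_ends_conv out_arcs_def image_iff)
  moreover have "finite (out_arcs G v)" by (simp add: out_arcs_def)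
  ultimately show "finite {u. v \<rightarrow>\<^bsub>G\<^esub> u}" "card {u. v \<rightarrow>\<^bsub>G\<^esub> u} \<le> out_degree G v"
    by (auto simp: out_degree_def card_image_le)
qed

lemma colorings_mono: "k \<le> l \<Longrightarrow> colorings G k \<subseteq> colorings G l"
  unfolding colorings_def using PiE_mono[of "verts G" "\<lambda>_. {1..k}" "\<lambda>_. {1..l}"] by auto

text \<open>Every edge of \<open>G - v\<close> is an edge of \<open>G\<close>, so properness is
  inherited. \<open>restrict\<close> sets the value at \<open>v\<close> to \<open>undefined\<close>,
  as the extensional encoding demands.\<close>

lemma restrict_colorings_del_vert:
  assumes "wf_digraph G" "c \<in> colorings G k"
  shows "restrict c (verts G - {v}) \<in> colorings (pre_digraph.del_vert G v) k"
proof -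
  interpret wf_digraph G by fact
  show ?thesis
    using assms(2)
    by (auto simp: colorings_def adj_del_vert_iff del_vert_simps dest: adj_in_verts)
qed

lemma colorings_fun_upd:
  assumes "graph G" "c \<in> colorings G k" "v \<in> verts G" "a \<in> {1..k}"
    and "\<And>u. v \<rightarrow>\<^bsub>G\<^esub> u \<Longrightarrow> c u \<noteq> a"
  shows "c(v := a) \<in> colorings G k"
proof -
  interpret graph G by fact
  \<comment> \<open>The hypothesis on \<open>a\<close> covers the arcs leaving \<open>v\<close>;
    symmetry gives the arcs entering \<open>v\<close>, and loop-freeness excludes
    \<open>x = y = v\<close>.\<close>
  have "(c(v := a)) x \<noteq> (c(v := a)) y" if "x \<rightarrow>\<^bsub>G\<^esub> y" for x y
    using that assms(2,5) graph_symmetric[OF that] adj_not_same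
    by (auto simp: colorings_def)
  then show ?thesis
    using assms(2-4) by (auto simp: colorings_def PiE_iff extensional_def)
qed

lemma verts_recoloring_graph [simp]: "verts (recoloring_graph G k) = colorings G k"
  by (simp add: recoloring_graph_def)

lemma adj_recoloring_graph_iff:
  "c \<rightarrow>\<^bsub>recoloring_graph G k\<^esub> d \<longleftrightarrow>
     c \<in> colorings G k \<and> d \<in> colorings G k \<and> (\<exists>!v. v \<in> verts G \<and> c v \<noteq> d v)"
  by (simp add: arcs_ends_conv recoloring_graph_def image_iff)

text \<open>The library defines connectedness as strong connectedness of the symmetric closure. The
  recoloring graph is already symmetric, so reachability is the same in both. The nonemptiness
  conjunct is part of strong connectedness.\<close>

lemma connected_recoloring_graph_iff:
  assumes "graph G"
  shows "Digraph_Component.connected (recoloring_graph G k) \<longleftrightarrow>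
    colorings G k \<noteq> {} \<and>
    (\<forall>c \<in> colorings G k. \<forall>d \<in> colorings G k. c \<rightarrow>\<^sup>*\<^bsub>recoloring_graph G k\<^esub> d)"
proof -
  interpret graph "recoloring_graph G k"
    using assms by (rule graph_recoloring_graph)
  show ?thesis
    using sym_arcs
    by (simp add: Digraph_Component.connected_def strongly_connected_def reachable_mk_symmetric_eq)
qed

text \<open>Reachability instead of adjacency lets \<open>a = c v\<close> count as the trivial walk,
  so callers need not ask whether the color really changes.\<close>

lemma reachable_fun_upd:
  assumes "graph G" "c \<in> colorings G k" "c(v := a) \<in> colorings G k" "v \<in> verts G"
  shows "c \<rightarrow>\<^sup>*\<^bsub>recoloring_graph G k\<^esub> c(v := a)"
proof -
  interpret R: graph "recoloring_graph G k"
    using assms(1) by (rule graph_recoloring_graph)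
  show ?thesis
  proof (cases "a = c v")
    case True
    then show ?thesis using assms(2) by simp
  next
    case False
    then have "c \<rightarrow>\<^bsub>recoloring_graph G k\<^esub> c(v := a)"
      using assms by (auto simp: adj_recoloring_graph_iff)
    then show ?thesis by (rule R.reachable_adjI)
  qed
qed

text \<open>At most \<open>card N + 1\<close> colors are forbidden, fewer than the \<open>k\<close>
  available.\<close>

lemma ex_color_avoiding:
  fixes c :: "'a \<Rightarrow> nat"
  assumes "finite N" "card N + 1 < k"
  obtains a where "a \<in> {1..k}" "a \<noteq> b" "a \<notin> c ` N"
proof -
  have "card (insert b (c ` N)) \<le> Suc (card N)"
    using card_image_le[OF assms(1), of c] assms(1) by (simp add: card_insert_if)
  then have "\<not> {1..k} \<subseteq> insert b (c ` N)"
    using assms card_mono[of "insert b (c ` N)" "{1..k}"] by fastforce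
  then show thesis using that by blast
qed

text \<open>Induction along the walk in \<open>G - v\<close>, each step lifting to a move of
  \<open>v\<close> followed by a move of \<open>w\<close>. The color of \<open>v\<close> in
  \<open>d\<close> is left free, since every step may change it.\<close>

lemma lift_recoloring_walk:
  fixes G :: "('a, 'b) pre_digraph"
  assumes "graph G" "v \<in> verts G" "out_degree G v + 1 < k" "c \<in> colorings G k"
    and "restrict c (verts G - {v}) \<rightarrow>\<^sup>*\<^bsub>recoloring_graph (pre_digraph.del_vert G v) k\<^esub> d'"
  shows "\<exists>d. c \<rightarrow>\<^sup>*\<^bsub>recoloring_graph G k\<^esub> d \<and> restrict d (verts G - {v}) = d'"
proof -
  let ?R = "recoloring_graph G k"
  interpret graph G by fact
  interpret R: graph ?R
    using assms(1) by (rule graph_recoloring_graph)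
  interpret R': graph "recoloring_graph (del_vert v) k"
    using assms(1) by (intro graph_recoloring_graph graph_del_vert)
  show ?thesis using assms(5)
  proof (induction rule: R'.reachable_induct)
    case base
    show ?case using assms(4) by (intro exI[of _ c]) simp
  next
    case (step x' y')
    then obtain x where cx: "c \<rightarrow>\<^sup>*\<^bsub>?R\<^esub> x" and x': "x' = restrict x (verts G - {v})" by blast
    have x: "x \<in> colorings G k"
      using R.reachable_in_verts(2)[OF cx] by simp
    obtain w where w_del: "w \<in> verts (del_vert v)"
      and uniq: "\<And>u. u \<in> verts (del_vert v) \<Longrightarrow> x' u \<noteq> y' u \<Longrightarrow> u = w"
      using step.hyps(2) unfolding adj_recoloring_graph_iff by blast
    have w: "w \<in> verts G" "w \<noteq> v" using w_del by (simp_all add: verts_del_vert)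
    have eq: "y' u = x u" if "u \<in> verts G" "u \<noteq> v" "u \<noteq> w" for u
      using uniq[of u] that unfolding x' verts_del_vert by fastforce
    have y': "y' \<in> colorings (del_vert v) k"
      using step.hyps(2) by (simp add: adj_recoloring_graph_iff)
    \<comment> \<open>Avoiding the colors of the neighbors makes it legal to recolor
      \<open>v\<close> with \<open>a\<close>; avoiding \<open>y' w\<close> keeps \<open>v\<close>
      from blocking the move of \<open>w\<close>.\<close>
    obtain a where a: "a \<in> {1..k}" "a \<noteq> y' w" "a \<notin> x ` {u. v \<rightarrow>\<^bsub>G\<^esub> u}"
      using ex_color_avoiding[OF card_neighbors_le_out_degree(1)[of v], of k "y' w" x]
        card_neighbors_le_out_degree(2)[of v] assms(3) by force
    define z where "z = x(v := a)"
    have z: "z \<in> colorings G k"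
      unfolding z_def using assms(1,2) x a by (intro colorings_fun_upd) auto
    \<comment> \<open>The color \<open>y' w\<close> is free at \<open>w\<close> in \<open>z\<close>:
      at \<open>v\<close> by the choice of \<open>a\<close>, at any other neighbor because
      \<open>y'\<close> is proper and agrees with \<open>x\<close> there.\<close>
    have "z u \<noteq> y' w" if "w \<rightarrow>\<^bsub>G\<^esub> u" for u
    proof (cases "u = v")
      case True
      then show ?thesis using a(2) by (simp add: z_def)
    next
      case False
      have "y' w \<noteq> y' u"
        using y' that w False by (simp add: colorings_def adj_del_vert_iff)
      moreover have "y' u = x u"
        using False that adj_not_same adj_in_verts(2) by (intro eq) auto
      ultimately show ?thesis using False by (simp add: z_def)
    qed
    moreover have "y' w \<in> {1..k}"
      using y' w_del unfolding colorings_def by blast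
    ultimately have zw: "z(w := y' w) \<in> colorings G k"
      using assms(1) z w by (intro colorings_fun_upd) auto
    have "x \<rightarrow>\<^sup>*\<^bsub>?R\<^esub> z"
      using reachable_fun_upd[OF assms(1) x _ assms(2)] z by (simp add: z_def)
    moreover have "z \<rightarrow>\<^sup>*\<^bsub>?R\<^esub> z(w := y' w)"
      using assms(1) z zw w(1) by (rule reachable_fun_upd)
    ultimately have "c \<rightarrow>\<^sup>*\<^bsub>?R\<^esub> z(w := y' w)"
      using cx R.reachable_trans by blast
    moreover have "restrict (z(w := y' w)) (verts G - {v}) = y'"
    proof
      fix u
      show "restrict (z(w := y' w)) (verts G - {v}) u = y' u"
      proof (cases "u \<in> verts G - {v}")
        case True
        then show ?thesis using eq[of u] by (simp add: z_def)
      next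
        case False
        \<comment> \<open>Equality of functions also concerns arguments outside
          \<open>G - v\<close>, where both sides take the default value.\<close>
        then have "y' u = undefined"
          using y' unfolding colorings_def verts_del_vert by (blast intro: PiE_arb)
        then show ?thesis using False by auto
      qed
    qed
    ultimately show ?case by blast
  qed
qed

lemma connected_recoloring_graph_if_del_vert:
  fixes G :: "('a, 'b) pre_digraph"
  assumes "graph G" "v \<in> verts G" "out_degree G v + 1 < k" "colorings G k \<noteq> {}"
    and "Digraph_Component.connected (recoloring_graph (pre_digraph.del_vert G v) k)"
  shows "Digraph_Component.connected (recoloring_graph G k)"
proof -
  let ?R = "recoloring_graph G k"
  interpret graph G by fact
  interpret R: graph ?R
    using assms(1) by (rule graph_recoloring_graph)
  have "c \<rightarrow>\<^sup>*\<^bsub>?R\<^esub> d" if c: "c \<in> colorings G k" and d: "d \<in> colorings G k" for c d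
  proof -
    have "restrict c (verts G - {v}) \<rightarrow>\<^sup>*\<^bsub>recoloring_graph (pre_digraph.del_vert G v) k\<^esub>
        restrict d (verts G - {v})"
      using assms(5) c d
      by (simp add: connected_recoloring_graph_iff[OF graph_del_vert[OF assms(1)]]
          restrict_colorings_del_vert[OF wf_digraph])
    from lift_recoloring_walk[OF assms(1-3) c this]
    obtain e where e: "c \<rightarrow>\<^sup>*\<^bsub>?R\<^esub> e"
      and eq: "restrict e (verts G - {v}) = restrict d (verts G - {v})" by blast
    have e_col: "e \<in> colorings G k"
      using R.reachable_in_verts(2)[OF e] by simp
    \<comment> \<open>Inside \<open>verts G\<close> this is \<open>eq\<close>; outside, both
      colorings are \<open>undefined\<close>. Hence one move of \<open>v\<close> turns
      \<open>e\<close> into \<open>d\<close>.\<close>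
    have "e u = d u" if "u \<noteq> v" for u
      using that fun_cong[OF eq, of u] e_col d
      by (cases "u \<in> verts G") (auto simp: colorings_def PiE_iff extensional_def)
    then have "e(v := d v) = d" by auto
    then have "e \<rightarrow>\<^sup>*\<^bsub>?R\<^esub> d"
      using reachable_fun_upd[OF assms(1) e_col _ assms(2), of "d v"] d by simp
    with e show ?thesis by (rule R.reachable_trans)
  qed
  with assms(4) show ?thesis
    by (simp add: connected_recoloring_graph_iff[OF assms(1)])
qed

text \<open>An optimal coloring of \<open>G\<close> restricts to \<open>G - v\<close>. Thus every
  \<open>l\<close> relevant for \<open>G\<close> lies in the range where recolorability of
  \<open>G - v\<close> applies.\<close>

lemma chromatic_number_del_vert_le:
  assumes "graph G"
  shows "chromatic_number (pre_digraph.del_vert G v) \<le> chromatic_number G"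
proof -
  interpret graph G by fact
  have "colorings (pre_digraph.del_vert G v) (chromatic_number G) \<noteq> {}"
    using colorings_chromatic_number_nonempty[OF assms] restrict_colorings_del_vert[OF wf_digraph]
    by (metis all_not_in_conv)
  then show ?thesis
    unfolding chromatic_number_def[of "pre_digraph.del_vert G v"] by (rule Least_le)
qed

theorem lemma2:
  fixes G :: "('a, 'b) pre_digraph" and v :: 'a
  assumes "graph G"
    and "v \<in> verts G"
    and "int (out_degree G v) \<le> int (chromatic_number G) - 1"
  shows "recolorable G \<or> \<not> recolorable (pre_digraph.del_vert G v)"
proof -
  have "recolorable G" if rec: "recolorable (pre_digraph.del_vert G v)"
    unfolding recolorable_def
  proof (intro allI impI)
    fix l assume l: "chromatic_number G + 1 \<le> l"
    have "Digraph_Component.connected (recoloring_graph (pre_digraph.del_vert G v) l)"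
      using rec l chromatic_number_del_vert_le[OF assms(1), of v]
      by (simp add: recolorable_def)
    moreover have "colorings G l \<noteq> {}"
      using colorings_chromatic_number_nonempty[OF assms(1)]
        colorings_mono[of "chromatic_number G" l G] l by auto
    \<comment> \<open>The degree is at most \<open>chromatic_number G - 1\<close>, hence at most
      \<open>l - 2\<close>: this leaves a color for \<open>v\<close> besides those of its neighbors
      and one further forbidden color.\<close>
    moreover have "out_degree G v + 1 < l"
      using assms(3) l by linarith
    ultimately show "Digraph_Component.connected (recoloring_graph G l)"
      using connected_recoloring_graph_if_del_vert[OF assms(1,2)] by blast
  qed
  then show ?thesis by blast
qed

end
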